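(* Suppose that: (A1) for each $i\in I$ there are $\theta_i\in(0,1]$ and $H_i>0$ with $\|\nabla f_i(x)-\nabla f_i(y)\|\le H_i\|y-x\|^{\theta_i}$ for all $x,y\in\Omega$; (A2) for each $i\in I$ there exists $f_i^*\in\mathbb{R}$ such that $f_i(x)\ge f_i^*$ for all $x\in\Omega$; (A3) $\lim_{T\to+\infty}\frac1T\sum_{k=0}^{T-1}[\nu_k]_i=0$ for each $i\in I$. For each $i\in I$ and $\delta>0$ let $C_i(\delta)>0$ be a number such that $$\frac1T\sum_{k=0}^{T-1}[\nu_k]_i\le\delta\quad\text{for all } T\ge C_i(\delta)$$ (such a number exists by A3). Let $\{x_k\}$ and $\{\nu_k\}$ be generated by the Universal Nonmonotone Line Search Method, let $\epsilon\in(0,1)$, and let $T$ be such that $\|s(x_k)\|>\epsilon$ for $k=0,\ldots,T-1$. Then $$T\le\min_{i\in I}\max\left\{C_i\left(\frac{\kappa_2}{2}\epsilon^{1+\frac1{\theta_{\min}}}\right),\ \frac{2(f_i(x_0)-f_i^* )}{\kappa_2}\epsilon^{-\left(1+\frac1{\theta_{\min}}\right)}\right\},$$ where $\theta_{\min}=\min_{i\in I}\theta_i$, $\kappa_2=c_1\rho\kappa_1$ and $$\kappa_1=\min\left\{1,\ \min_{i\in I}\left\{\beta\left[\frac{(1+\theta_i)c_1(1-\rho)}{c_2^{1+\theta_i}H_i}\right]^{\frac1{\theta_i}}\right\}\right\}.$$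
   Context: Setting: $\emptyset\ne\Omega\subset\mathbb{R}^n$ is closed and convex, $F=(f_1,\ldots,f_m)^T:\mathbb{R}^n\to\mathbb{R}^m$ is continuously differentiable (possibly nonconvex), $I=\{1,\ldots,m\}$, $\|\cdot\|$ is the Euclidean norm, $\mathbb{R}^m_+=\{z\in\mathbb{R}^m: z_i\ge0,\ i\in I\}$. For $x\in\Omega$, $\Omega-x=\{y\in\mathbb{R}^n: y+x\in\Omega\}$, and $s(x)$ is the unique minimizer over $d\in\Omega-x$ of $\max_{i\in I}\{\nabla f_i(x)^Td\}+\frac12\|d\|^2$. Universal Nonmonotone Line Search Method. Parameters: $x_0\in\Omega$, $m_0\in\{0,1,\ldots,m\}$, $c_1,c_2>0$, $\beta,\rho\in(0,1)$. At each iteration $k=0,1,2,\ldots$: (Step 1) choose $d(x_k)\in\Omega-x_k$ with $\max_{i\in I}\{\nabla f_i(x_k)^Td(x_k)\}\le-c_1\|s(x_k)\|^2$ and $\|d(x_k)\|\le c_2\|s(x_k)\|$. (Step 2) For $\ell=0,1,2,\ldots$ choose $\nu_{k,\ell}\in\mathbb{R}^m_+$ (arbitrarily), and let $\ell_k$ be the first $\ell$ for which both of the following hold: (i) the number of indices $i\in I$ with $f_i(x_k+\beta^\ell d(x_k))\le f_i(x_k)+\rho\beta^\ell\nabla f_i(x_k)^Td(x_k)$ is at least $m_k$; (ii) $f_i(x_k+\beta^\ell d(x_k))\le f_i(x_k)+\rho\beta^\ell\nabla f_i(x_k)^Td(x_k)+[\nu_{k,\ell}]_i$ for all $i\in I$.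 (Step 3) Set $\alpha_k=\beta^{\ell_k}$, $x_{k+1}=x_k+\alpha_kd(x_k)$, $\nu_k=\nu_{k,\ell_k}$, and choose $m_{k+1}\in\{0,1,\ldots,m\}$ (arbitrarily). *)

theory Defs
  imports "HOL-Analysis.Analysis"
begin

definition continuously_differentiable ::
  "('a::euclidean_space \<Rightarrow> 'b::euclidean_space) \<Rightarrow> bool" where
  "continuously_differentiable F \<longleftrightarrow>
     (\<exists>F' :: 'a \<Rightarrow> 'a \<Rightarrow>\<^sub>L 'b.
        (\<forall>x. (F has_derivative blinfun_apply (F' x)) (at x)) \<and> continuous_on UNIV F')"

definition gradient :: "('a::euclidean_space \<Rightarrow> real) \<Rightarrow> 'a \<Rightarrow> 'a" where
  "gradient f x = (THE g. GDERIV f x :> g)"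

abbreviation grad_comp :: "(real^'n \<Rightarrow> real^'m) \<Rightarrow> 'm \<Rightarrow> real^'n \<Rightarrow> real^'n" where
  "grad_comp F i \<equiv> gradient (\<lambda>y. F y $ i)"

definition feasible_directions :: "(real^'n) set \<Rightarrow> real^'n \<Rightarrow> (real^'n) set" where
  "feasible_directions \<Omega> x = {y. y + x \<in> \<Omega>}"

definition max_slope :: "(real^'n \<Rightarrow> real^'m) \<Rightarrow> real^'n \<Rightarrow> real^'n \<Rightarrow> real" where
  "max_slope F x d = (MAX i. grad_comp F i x \<bullet> d)"

(* The minimizer exists and is unique whenever \<Omega> is closed and convex and x \<in> \<Omega>:
   the objective is continuous, strongly convex and coercive in d. *)
definition steepest_direction ::
  "(real^'n) set \<Rightarrow> (real^'n \<Rightarrow> real^'m) \<Rightarrow> real^'n \<Rightarrow> real^'n" where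
  "steepest_direction \<Omega> F x =
     (THE d. is_arg_min (\<lambda>d. max_slope F x d + 1/2 * (norm d)^2)
               (\<lambda>d. d \<in> feasible_directions \<Omega> x) d)"

definition sufficient_decrease ::
  "(real^'n \<Rightarrow> real^'m) \<Rightarrow> real \<Rightarrow> real^'n \<Rightarrow> real^'n \<Rightarrow> real \<Rightarrow> real \<Rightarrow> 'm \<Rightarrow> bool" where
  "sufficient_decrease F \<rho> x d t v i \<longleftrightarrow>
     F (x + t *\<^sub>R d) $ i \<le> F x $ i + \<rho> * t * (grad_comp F i x \<bullet> d) + v"

(* Acceptance test for step size t: plain Armijo decrease (slack 0) in at least
   p components, and decrease up to the slack v in all of them. *)
definition step_accepted ::
  "(real^'n \<Rightarrow> real^'m) \<Rightarrow> real \<Rightarrow> nat \<Rightarrow> real^'n \<Rightarrow> real^'n \<Rightarrow> real \<Rightarrow> real^'m \<Rightarrow> bool" where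
  "step_accepted F \<rho> p x d t v \<longleftrightarrow>
     p \<le> card {i. sufficient_decrease F \<rho> x d t 0 i} \<and>
     (\<forall>i. sufficient_decrease F \<rho> x d t (v $ i) i)"

(* One run of the method: x k are the iterates, d k the search directions, ms k the
   numbers of components with plain decrease, nu k l the slack tried at trial l of
   iteration k, and ell k the index of the first accepted trial. Slacks are only
   constrained for the trials that actually take place, l \<le> ell k. *)
definition universal_nonmonotone_line_search ::
  "(real^'n) set \<Rightarrow> (real^'n \<Rightarrow> real^'m) \<Rightarrow> real \<Rightarrow> real \<Rightarrow> real \<Rightarrow> real \<Rightarrow>
   (nat \<Rightarrow> real^'n) \<Rightarrow> (nat \<Rightarrow> real^'n) \<Rightarrow> (nat \<Rightarrow> nat) \<Rightarrow>
   (nat \<Rightarrow> nat \<Rightarrow> real^'m) \<Rightarrow> (nat \<Rightarrow> nat) \<Rightarrow> bool" where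
  "universal_nonmonotone_line_search \<Omega> F c1 c2 \<beta> \<rho> x d ms nu ell \<longleftrightarrow>
     x 0 \<in> \<Omega> \<and>
     (\<forall>k. ms k \<le> CARD('m)) \<and>
     (\<forall>k. d k \<in> feasible_directions \<Omega> (x k) \<and>
          max_slope F (x k) (d k) \<le> - c1 * (norm (steepest_direction \<Omega> F (x k)))^2 \<and>
          norm (d k) \<le> c2 * norm (steepest_direction \<Omega> F (x k))) \<and>
     (\<forall>k. (\<forall>l\<le>ell k. \<forall>i. 0 \<le> nu k l $ i) \<and>
          step_accepted F \<rho> (ms k) (x k) (d k) (\<beta> ^ ell k) (nu k (ell k)) \<and>
          (\<forall>l<ell k. \<not> step_accepted F \<rho> (ms k) (x k) (d k) (\<beta> ^ l) (nu k l))) \<and>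
     (\<forall>k. x (Suc k) = x k + \<beta> ^ ell k *\<^sub>R d k)"

end

theory Submission
  imports Defs
begin

text \<open>
  A rejected trial step violates the plain Armijo test in some component, whichever of the two
  acceptance conditions fails. By the Holder descent lemma the last rejected step, hence also the
  accepted one, is then bounded below by \<open>\<kappa>1 * \<epsilon> powr (1 / \<theta>min - 1)\<close>. So each of the
  first \<open>T\<close> iterations decreases every component by at least \<open>\<kappa>2 * \<epsilon> powr (1 + 1 / \<theta>min)\<close>
  up to the slack. Telescoping, and absorbing the average slack into half of this decrease once
  \<open>T\<close> exceeds \<open>C i\<close>, gives the bound.
\<close>

text \<open>\<open>gradient\<close> is a definite description, so it needs a witness and uniqueness.
  The Riesz representer of the derivative, \<open>adjoint f' 1\<close>, is the witness; uniqueness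
  of derivatives settles the rest.\<close>

lemma GDERIV_gradient:
  assumes "(f has_derivative f') (at x)"
  shows "GDERIV f x :> gradient f x"
proof -
  obtain g where g: "GDERIV f x :> g"
  proof
    interpret linear f' using assms by (rule has_derivative_linear)
    have "f' = (\<lambda>h. h \<bullet> adjoint f' 1)"
      using adjoint_works[OF linear_axioms, of _ 1] by auto
    then show "GDERIV f x :> adjoint f' 1"
      using assms by (simp add: gderiv_def)
  qed
  have "g' = g" if "GDERIV f x :> g'" for g'
  proof -
    have "(\<lambda>h. h \<bullet> g') = (\<lambda>h. h \<bullet> g)"
      using has_derivative_unique that g unfolding gderiv_def by blast
    then show ?thesis
      by (metis vector_eq_ldot)
  qed
  with g show ?thesis
    unfolding gradient_def by (rule theI[of "\<lambda>g. GDERIV f x :> g"])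
qed

lemma continuously_differentiable_GDERIV_component:
  assumes "continuously_differentiable F"
  shows "GDERIV (\<lambda>y. F y $ i) x :> grad_comp F i x"
proof -
  obtain F' where "(F has_derivative blinfun_apply (F' x)) (at x)"
    using assms unfolding continuously_differentiable_def by blast
  then have "((\<lambda>y. F y $ i) has_derivative (\<lambda>h. blinfun_apply (F' x) h $ i)) (at x)"
    by (rule bounded_linear.has_derivative[OF bounded_linear_vec_nth])
  then show ?thesis
    by (rule GDERIV_gradient)
qed

text \<open>Integration is avoided: \<open>\<phi>\<close>, the error of the linear model minus the
  Holder term, has nonpositive derivative along the ray by Cauchy-Schwarz. The Holder bound is asked
  only on the segment and only against its base point, since gradients are controlled only inside a
  convex set.\<close>

lemma Holder_descent:
  fixes f :: "'a::euclidean_space \<Rightarrow> real"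
  assumes deriv: "\<And>y. GDERIV f y :> g y"
    and holder: "\<And>u. u \<in> closed_segment x (x + d) \<Longrightarrow> norm (g u - g x) \<le> H * norm (u - x) powr \<theta>"
    and "0 < \<theta>" and t: "0 \<le> t" "t \<le> 1"
  shows "f (x + t *\<^sub>R d) \<le> f x + t * (g x \<bullet> d) + H / (1 + \<theta>) * (t * norm d) powr (1 + \<theta>)"
proof -
  define \<phi> where "\<phi> r = f (x + r *\<^sub>R d) - r * (g x \<bullet> d)
      - H / (1 + \<theta>) * (r powr (1 + \<theta>) * norm d powr (1 + \<theta>))" for r
  define \<phi>' where "\<phi>' r = g (x + r *\<^sub>R d) \<bullet> d - g x \<bullet> d
      - H * (r powr \<theta> * norm d powr (1 + \<theta>))" for r
  have line: "((\<lambda>r. f (x + r *\<^sub>R d)) has_real_derivative g (x + r *\<^sub>R d) \<bullet> d) (at r)" for r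
  proof -
    have "((\<lambda>r. x + r *\<^sub>R d) has_derivative (\<lambda>r. r *\<^sub>R d)) (at r)"
      by (auto intro!: derivative_eq_intros)
    from has_derivative_compose[OF this deriv[unfolded gderiv_def]] show ?thesis
      by (simp add: has_field_derivative_def mult_commute_abs inner_commute)
  qed
  \<comment> \<open>The sign of \<open>\<phi>'\<close> is checked only on the open interval, where
    \<open>r > 0\<close> makes the power rule for \<open>powr\<close> applicable; at the endpoints
    continuity suffices.\<close>
  have "\<phi> t \<le> \<phi> 0"
  proof (rule DERIV_nonpos_imp_decreasing_open[OF t(1)])
    fix r assume r: "0 < r" "r < t"
    have "(\<phi> has_real_derivative \<phi>' r) (at r)"
      unfolding \<phi>_def[abs_def] \<phi>'_def using r \<open>0 < \<theta>\<close>
      by (auto intro!: derivative_eq_intros line)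
    moreover have "\<phi>' r \<le> 0"
    proof -
      have "x + r *\<^sub>R d \<in> closed_segment x (x + d)"
        using r t by (auto simp: closed_segment_def algebra_simps intro!: exI[of _ r])
      then have "norm (g (x + r *\<^sub>R d) - g x) \<le> H * (r * norm d) powr \<theta>"
        using holder r by fastforce
      then have "(g (x + r *\<^sub>R d) - g x) \<bullet> d \<le> H * (r * norm d) powr \<theta> * norm d"
        by (meson norm_cauchy_schwarz mult_right_mono norm_ge_zero order_trans)
      also have "\<dots> = H * (r powr \<theta> * norm d powr (1 + \<theta>))"
        using r by (simp add: powr_mult powr_add)
      finally show ?thesis
        by (simp add: \<phi>'_def inner_diff_left)
    qed
    ultimately show "\<exists>y. (\<phi> has_real_derivative y) (at r) \<and> y \<le> 0"
      by blast
  next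
    have "continuous_on {0..t} (\<lambda>r. f (x + r *\<^sub>R d))"
      using line by (intro continuous_at_imp_continuous_on ballI DERIV_isCont)
    then show "continuous_on {0..t} \<phi>"
      unfolding \<phi>_def[abs_def] using \<open>0 < \<theta>\<close>
      by (intro continuous_intros continuous_on_powr') auto
  qed
  then show ?thesis
    using t by (simp add: \<phi>_def powr_mult)
qed

text \<open>The first factor on the left, times \<open>\<beta>\<close>, is the constant in \<open>\<kappa>1\<close>.\<close>

lemma Armijo_failure_step_lower_bound:
  fixes s t :: real
  assumes pos: "0 < c1" "0 < c2" "\<rho> < 1" "0 < H" "0 < \<theta>" "0 < s" "0 < t"
    and slope: "p \<le> - c1 * s^2" and dir: "0 \<le> n" "n \<le> c2 * s"
    and fail: "\<rho> * t * p < t * p + H / (1 + \<theta>) * (t * n) powr (1 + \<theta>)"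
  shows "(((1 + \<theta>) * c1 * (1 - \<rho>)) / (c2 powr (1 + \<theta>) * H)) powr (1 / \<theta>) * s powr (1 / \<theta> - 1) \<le> t"
proof -
  define B where "B = ((1 + \<theta>) * c1 * (1 - \<rho>)) / (c2 powr (1 + \<theta>) * H)"
  have "0 < B" using pos by (simp add: B_def)
  have "t * ((1 - \<rho>) * (c1 * s^2)) \<le> t * ((1 - \<rho>) * (- p))"
    using pos slope by (intro mult_left_mono) auto
  also have "\<dots> < H / (1 + \<theta>) * (t * n) powr (1 + \<theta>)"
    using fail by (simp add: algebra_simps)
  also have "\<dots> \<le> H / (1 + \<theta>) * (t * (c2 * s)) powr (1 + \<theta>)"
    using pos dir by (intro mult_left_mono powr_mono2) auto
  also have "\<dots> = t * (H / (1 + \<theta>) * (c2 powr (1 + \<theta>) * (t powr \<theta> * s powr (1 + \<theta>))))"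
    using pos by (simp add: powr_mult powr_add)
  finally have "(1 - \<rho>) * (c1 * s^2) < H / (1 + \<theta>) * (c2 powr (1 + \<theta>) * (t powr \<theta> * s powr (1 + \<theta>)))"
    using pos by (simp only: mult_less_cancel_left_pos)
  \<comment> \<open>This splitting lets \<open>s powr (1 + \<theta>)\<close> cancel on both sides.
    What remains is the exponent 1 - \<theta>, which raising to the power 1 / \<theta> turns into 1
    / \<theta> - 1.\<close>
  moreover have "s^2 = s powr (1 - \<theta>) * s powr (1 + \<theta>)"
    using pos by (simp flip: powr_add)
  ultimately have "((1 - \<rho>) * c1 * s powr (1 - \<theta>)) * s powr (1 + \<theta>)
      < (H / (1 + \<theta>) * c2 powr (1 + \<theta>) * t powr \<theta>) * s powr (1 + \<theta>)"
    by (simp add: mult_ac)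
  then have "(1 - \<rho>) * c1 * s powr (1 - \<theta>) < H / (1 + \<theta>) * c2 powr (1 + \<theta>) * t powr \<theta>"
    using pos by (simp only: mult_less_cancel_right_pos powr_gt_zero)
  then have "B * s powr (1 - \<theta>) \<le> t powr \<theta>"
    using pos by (simp add: B_def field_simps)
  then have "(B * s powr (1 - \<theta>)) powr (1 / \<theta>) \<le> (t powr \<theta>) powr (1 / \<theta>)"
    using pos \<open>0 < B\<close> by (intro powr_mono2) auto
  then show ?thesis
    using pos \<open>0 < B\<close> by (simp add: powr_mult powr_powr diff_divide_distrib flip: B_def)
qed

text \<open>If every component passed with zero slack, the count would be \<open>CARD('m)\<close>,
  hence at least \<open>p\<close>, and nonnegative slacks could only relax the remaining
  test.\<close>

lemma not_step_accepted_imp_not_Armijo: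
  fixes F :: "real^'n \<Rightarrow> real^'m"
  assumes "\<not> step_accepted F \<rho> p x d t v" "p \<le> CARD('m)" "\<And>i. 0 \<le> v $ i"
  obtains i where "\<not> sufficient_decrease F \<rho> x d t 0 i"
proof (rule ccontr)
  assume "\<not> thesis"
  then have *: "sufficient_decrease F \<rho> x d t 0 i" for i
    using that by blast
  then have "sufficient_decrease F \<rho> x d t (v $ i) i" for i
    using add_mono[OF *[of i, unfolded sufficient_decrease_def] assms(3)[of i]]
    by (simp add: sufficient_decrease_def)
  then show False
    using assms(1,2) * by (simp add: step_accepted_def)
qed

text \<open>Each new iterate is a convex combination of \<open>x k\<close> and the feasible point
  \<open>x k + d k\<close>, with weight \<open>\<beta> ^ ell k\<close> at most 1. Feasibility is
  what gives access to the Holder and lower bounds, which hold only on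
  \<open>\<Omega>\<close>.\<close>

lemma line_search_iterates_in:
  fixes F :: "real^'n \<Rightarrow> real^'m"
  assumes "convex \<Omega>" "0 < \<beta>" "\<beta> < 1"
    and "universal_nonmonotone_line_search \<Omega> F c1 c2 \<beta> \<rho> x d ms nu ell"
  shows "x k \<in> \<Omega>"
proof (induction k)
  case 0
  then show ?case
    using assms(4) by (simp add: universal_nonmonotone_line_search_def)
next
  case (Suc k)
  have "x k + d k \<in> \<Omega>"
    using assms(4)
    by (simp add: universal_nonmonotone_line_search_def feasible_directions_def add.commute)
  then have "(1 - \<beta> ^ ell k) *\<^sub>R x k + \<beta> ^ ell k *\<^sub>R (x k + d k) \<in> \<Omega>"
    using Suc assms by (intro convexD) (auto simp: power_le_one)
  then show ?case
    using assms(4) by (simp add: universal_nonmonotone_line_search_def algebra_simps)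
qed

theorem theorem3p6:
  fixes \<Omega> :: "(real^'n) set"
    and F :: "real^'n \<Rightarrow> real^'m"
    and x d :: "nat \<Rightarrow> real^'n"
    and ms ell :: "nat \<Rightarrow> nat"
    and nu :: "nat \<Rightarrow> nat \<Rightarrow> real^'m"
    and \<theta> H fstar :: "'m \<Rightarrow> real"
    and C :: "'m \<Rightarrow> real \<Rightarrow> real"
    and c1 c2 \<beta> \<rho> \<epsilon> \<theta>min \<kappa>1 \<kappa>2 :: real
    and T :: nat
  assumes "\<Omega> \<noteq> {}" and "closed \<Omega>" and "convex \<Omega>"
    and "continuously_differentiable F"
    and "c1 > 0" and "c2 > 0" and "0 < \<beta>" and "\<beta> < 1" and "0 < \<rho>" and "\<rho> < 1"
    and run: "universal_nonmonotone_line_search \<Omega> F c1 c2 \<beta> \<rho> x d ms nu ell"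
    and A1: "\<And>i. 0 < \<theta> i \<and> \<theta> i \<le> 1 \<and> H i > 0"
      "\<And>i u v. u \<in> \<Omega> \<Longrightarrow> v \<in> \<Omega> \<Longrightarrow>
         norm (grad_comp F i u - grad_comp F i v) \<le> H i * norm (v - u) powr \<theta> i"
    and A2: "\<And>i u. u \<in> \<Omega> \<Longrightarrow> F u $ i \<ge> fstar i"
    and A3: "\<And>i. (\<lambda>N. 1 / real N * (\<Sum>k<N. nu k (ell k) $ i)) \<longlonglongrightarrow> 0"
    and C: "\<And>i \<delta>. \<delta> > 0 \<Longrightarrow> C i \<delta> > 0"
      "\<And>i \<delta> N. \<delta> > 0 \<Longrightarrow> real N \<ge> C i \<delta> \<Longrightarrow>
         1 / real N * (\<Sum>k<N. nu k (ell k) $ i) \<le> \<delta>"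
    and "0 < \<epsilon>" and "\<epsilon> < 1"
    and T: "\<And>k. k < T \<Longrightarrow> norm (steepest_direction \<Omega> F (x k)) > \<epsilon>"
    and \<theta>min: "\<theta>min = (MIN i. \<theta> i)"
    and \<kappa>1: "\<kappa>1 = min 1 (MIN i.
        \<beta> * (((1 + \<theta> i) * c1 * (1 - \<rho>)) / (c2 powr (1 + \<theta> i) * H i)) powr (1 / \<theta> i))"
    and \<kappa>2: "\<kappa>2 = c1 * \<rho> * \<kappa>1"
  shows "real T \<le> (MIN i. max
           (C i (\<kappa>2 / 2 * \<epsilon> powr (1 + 1 / \<theta>min)))
           (2 * (F (x 0) $ i - fstar i) / \<kappa>2 * \<epsilon> powr (- (1 + 1 / \<theta>min))))"
proof -
  note run' = run[unfolded universal_nonmonotone_line_search_def]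
  \<comment> \<open>\<open>B i\<close> is the constant in \<open>\<kappa>1\<close> without its
    factor \<open>\<beta>\<close>: it governs a rejected step, and \<open>\<beta>\<close> returns on
    passing to the accepted one.\<close>
  define B where
    "B i = (((1 + \<theta> i) * c1 * (1 - \<rho>)) / (c2 powr (1 + \<theta> i) * H i)) powr (1 / \<theta> i)" for i
  define s where "s k = norm (steepest_direction \<Omega> F (x k))" for k
  define E where "E = \<epsilon> powr (1 + 1 / \<theta>min)"
  have x_in: "x k \<in> \<Omega>" for k
    using line_search_iterates_in[OF _ _ _ run] assms by blast
  have \<theta>min_le: "\<theta>min \<le> \<theta> i" for i
    unfolding \<theta>min by simp
  have \<theta>min_pos: "0 < \<theta>min"
    unfolding \<theta>min using A1(1) by (subst Min_gr_iff) auto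
  then have \<theta>min_inv: "1 / \<theta> i \<le> 1 / \<theta>min" "1 \<le> 1 / \<theta> i" for i
    using A1(1)[of i] \<theta>min_le[of i] by (auto simp: field_simps)
  then have \<theta>min_inv1: "1 \<le> 1 / \<theta>min"
    by (meson order_trans)
  have \<kappa>1_le: "\<kappa>1 \<le> 1" "\<kappa>1 \<le> \<beta> * B i" for i
    unfolding \<kappa>1 B_def by (auto intro!: min.coboundedI2 Min_le)
  have \<beta>B_pos: "0 < \<beta> * B i" for i
    using A1(1)[of i] assms(5-10) by (auto simp: B_def)
  then have \<kappa>1_pos: "0 < \<kappa>1"
    unfolding \<kappa>1 using \<beta>B_pos by (auto simp: Min_gr_iff B_def)
  then have \<kappa>2_pos: "0 < \<kappa>2"
    using assms by simp
  have E_pos: "0 < E"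
    using \<open>0 < \<epsilon>\<close> by (simp add: E_def)
  have slope: "grad_comp F i (x k) \<bullet> d k \<le> - c1 * (s k)^2" for i k
  proof -
    have "grad_comp F i (x k) \<bullet> d k \<le> max_slope F (x k) (d k)"
      unfolding max_slope_def by simp
    also have "\<dots> \<le> - c1 * (s k)^2"
      using run' by (simp add: s_def)
    finally show ?thesis .
  qed
  have step: "\<kappa>1 * \<epsilon> powr (1 / \<theta>min - 1) \<le> \<beta> ^ ell k" if "k < T" for k
  proof (cases "ell k")
    \<comment> \<open>The unit step is accepted at once; the entry 1 in the minimum defining
      \<open>\<kappa>1\<close> covers this case.\<close>
    case 0
    have "\<epsilon> powr (1 / \<theta>min - 1) \<le> 1"
      using \<open>0 < \<epsilon>\<close> \<open>\<epsilon> < 1\<close> \<theta>min_inv1 by (intro powr_le1) auto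
    then show ?thesis
      using 0 \<kappa>1_le(1) \<kappa>1_pos by (simp add: mult_le_one)
  next
    case (Suc l)
    \<comment> \<open>\<open>t\<close> is the last rejected step, so the accepted step is
      \<open>\<beta> * t\<close>.\<close>
    define t where "t = \<beta> ^ l"
    have t: "0 < t" "t \<le> 1"
      using assms by (auto simp: t_def power_le_one)
    have "\<not> step_accepted F \<rho> (ms k) (x k) (d k) t (nu k l)" "\<And>i. 0 \<le> nu k l $ i" "ms k \<le> CARD('m)"
      using run' Suc by (auto simp: t_def)
    then obtain i where i: "\<not> sufficient_decrease F \<rho> (x k) (d k) t 0 i"
      using not_step_accepted_imp_not_Armijo by blast
    let ?p = "grad_comp F i (x k) \<bullet> d k"
    have "x k + d k \<in> \<Omega>"
      using run' by (simp add: feasible_directions_def add.commute)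
    then have "closed_segment (x k) (x k + d k) \<subseteq> \<Omega>"
      using x_in \<open>convex \<Omega>\<close> by (simp add: closed_segment_subset)
    then have "norm (grad_comp F i u - grad_comp F i (x k)) \<le> H i * norm (u - x k) powr \<theta> i"
      if "u \<in> closed_segment (x k) (x k + d k)" for u
      using A1(2)[of u "x k" i] that x_in[of k] by (auto simp: norm_minus_commute)
    then have "F (x k + t *\<^sub>R d k) $ i
        \<le> F (x k) $ i + t * ?p + H i / (1 + \<theta> i) * (t * norm (d k)) powr (1 + \<theta> i)"
      using A1(1)[of i] t continuously_differentiable_GDERIV_component[OF \<open>continuously_differentiable F\<close>]
      by (intro Holder_descent) auto
    then have "\<rho> * t * ?p < t * ?p + H i / (1 + \<theta> i) * (t * norm (d k)) powr (1 + \<theta> i)"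
      using i by (simp add: sufficient_decrease_def)
    moreover have s: "\<epsilon> < s k"
      using T[OF that] by (simp add: s_def)
    moreover have "norm (d k) \<le> c2 * s k"
      using run' by (simp add: s_def)
    ultimately have Bt: "B i * s k powr (1 / \<theta> i - 1) \<le> t"
      unfolding B_def using assms(5-10) \<open>0 < \<epsilon>\<close> A1(1)[of i] t slope[of i k]
      by (intro Armijo_failure_step_lower_bound[of _ _ _ _ _ _ _ ?p "norm (d k)"]) auto
    \<comment> \<open>The failing component \<open>i\<close> varies with \<open>k\<close>, so the
      bound is made uniform: lowering the exponent raises the power because
      \<open>\<epsilon> < 1\<close>, and 1 / \<theta> i - 1 is nonnegative, so the base may grow
      from \<open>\<epsilon>\<close> to \<open>s k\<close>.\<close>
    have "\<epsilon> powr (1 / \<theta>min - 1) \<le> \<epsilon> powr (1 / \<theta> i - 1)"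
      using \<theta>min_inv[of i] \<open>0 < \<epsilon>\<close> \<open>\<epsilon> < 1\<close> by (intro powr_mono') auto
    also have "\<dots> \<le> s k powr (1 / \<theta> i - 1)"
      using \<theta>min_inv[of i] \<open>0 < \<epsilon>\<close> s by (intro powr_mono2) auto
    finally have "\<kappa>1 * \<epsilon> powr (1 / \<theta>min - 1) \<le> (\<beta> * B i) * s k powr (1 / \<theta> i - 1)"
      using \<kappa>1_le(2)[of i] \<beta>B_pos[of i] by (intro mult_mono) auto
    also have "\<dots> \<le> \<beta> * t"
      using Bt \<open>0 < \<beta>\<close> by (simp add: mult.assoc)
    finally show ?thesis
      by (simp add: Suc t_def)
  qed
  have decrease: "F (x (Suc k)) $ i \<le> F (x k) $ i - \<kappa>2 * E + nu k (ell k) $ i" if "k < T" for i k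
  proof -
    \<comment> \<open>The exponent of \<open>E\<close> is 1 / \<theta>min - 1 from the step size
      plus 2 from the squared norm in the slope bound.\<close>
    have "\<kappa>2 * E = \<rho> * c1 * ((\<kappa>1 * \<epsilon> powr (1 / \<theta>min - 1)) * \<epsilon>^2)"
    proof -
      have "E = \<epsilon> powr ((1 / \<theta>min - 1) + 2)"
        by (simp add: E_def algebra_simps)
      also have "\<dots> = \<epsilon> powr (1 / \<theta>min - 1) * \<epsilon>^2"
        using \<open>0 < \<epsilon>\<close> by (subst powr_add) simp
      finally show ?thesis
        by (simp add: \<kappa>2)
    qed
    also have "\<dots> \<le> \<rho> * c1 * (\<beta> ^ ell k * (s k)^2)"
      using step[OF that] T[OF that] assms
      by (intro mult_left_mono mult_mono power_mono) (auto simp: s_def)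
    also have "\<dots> = \<rho> * \<beta> ^ ell k * (c1 * (s k)^2)"
      by simp
    also have "\<dots> \<le> \<rho> * \<beta> ^ ell k * - (grad_comp F i (x k) \<bullet> d k)"
      using slope[of i k] assms by (intro mult_left_mono) auto
    finally have "\<kappa>2 * E \<le> - (\<rho> * \<beta> ^ ell k * (grad_comp F i (x k) \<bullet> d k))"
      by simp
    moreover have "F (x (Suc k)) $ i
        \<le> F (x k) $ i + \<rho> * \<beta> ^ ell k * (grad_comp F i (x k) \<bullet> d k) + nu k (ell k) $ i"
      using run' by (simp add: step_accepted_def sufficient_decrease_def)
    ultimately show ?thesis
      by simp
  qed
  \<comment> \<open>The range stops at \<open>T\<close> because the decrease is guaranteed only
    while \<open>s k\<close> exceeds \<open>\<epsilon>\<close>.\<close>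
  have telescope: "F (x N) $ i \<le> F (x 0) $ i - real N * (\<kappa>2 * E) + (\<Sum>k<N. nu k (ell k) $ i)"
    if "N \<le> T" for N i
    using that
  proof (induction N)
    case (Suc N)
    then show ?case
      using decrease[of N i] by (simp add: algebra_simps)
  qed simp
  have "real T \<le> max (C i (\<kappa>2 / 2 * E)) (2 * (F (x 0) $ i - fstar i) / \<kappa>2 * (1 / E))" for i
  \<comment> \<open>If \<open>T\<close> is below the threshold, the first entry of the maximum
    bounds it. Otherwise the average slack is at most half of the guaranteed decrease
    \<open>\<kappa>2 * E\<close>, and the other half gives the factor 2 in the second entry.\<close>
  proof (cases "C i (\<kappa>2 / 2 * E) \<le> real T")
    case True
    have "0 < \<kappa>2 / 2 * E"
      using \<kappa>2_pos E_pos by simp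
    \<comment> \<open>Positivity of \<open>C\<close> excludes \<open>T = 0\<close>, where
      \<open>1 / real T\<close> would be 0 and the average could not be multiplied out.\<close>
    then have "0 < real T" "1 / real T * (\<Sum>k<T. nu k (ell k) $ i) \<le> \<kappa>2 / 2 * E"
      using C(1)[of "\<kappa>2 / 2 * E" i] C(2)[of "\<kappa>2 / 2 * E" i T] True by linarith+
    then have "(\<Sum>k<T. nu k (ell k) $ i) \<le> real T * (\<kappa>2 * E) / 2"
      by (simp add: field_simps)
    then have "real T * (\<kappa>2 * E) \<le> 2 * (F (x 0) $ i - fstar i)"
      using telescope[of T i] A2[OF x_in, of i T] by simp
    then have "real T \<le> 2 * (F (x 0) $ i - fstar i) / \<kappa>2 * (1 / E)"
      using \<kappa>2_pos E_pos by (simp add: field_simps)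
    then show ?thesis
      by simp
  qed simp
  then show ?thesis
    unfolding powr_minus_divide E_def by (subst Min_ge_iff) auto
qed

end
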